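(* Let $\mathcal D$ be a block design with parameters $(v,b,r,k,\lambda)$ on $V$. If there is a subgroup $G$ of the automorphism group $\mathrm{Aut}(\mathcal D)$ acting transitively on the set $V^{(2)}$ of unordered pairs of distinct elements of $V$, then $\mathcal P(\mathcal D)$ is a system of pairs.
   Context: A block design with parameters $(v,b,r,k,\lambda)$ (with $b,r,k,\lambda$ positive integers and $k<v$) on a finite set $V$ with $|V|=v$ is a collection (repetitions allowed) of $b$ blocks $B_1,\dots,B_b$, each a $k$-element subset of $V$, such that every element of $V$ lies in exactly $r$ blocks and every pair of distinct elements of $V$ is contained in exactly $\lambda$ blocks. $\mathrm{Aut}(\mathcal D)$ is the group of permutations $\phi$ of $V$ that map the collection of blocks to itself, i.e. there is a permutation $\pi_\phi$ of $\{1,\dots,b\}$ with $\phi(B_j)=B_{\pi_\phi(j)}$ for all $j$; it acts on $V^{(2)}$ by $\phi(\{x,y\})=\{\phi(x),\phi(y)\}$. For an unordered pair $\{x,y\}\in V^{(2)}$, let $\mathcal Z^+(x,y)\in\{0,1\}^b$ be the vector with $j$th entry $|\chi_{B_j}(x)-\chi_{B_j}(y)|$, where $\chi_B$ is the characteristic function of $B$. Two unordered pairs are equivalent with respect to $\mathcal D$, written $\{x,y\}\sim_{\mathcal D}\{\alpha,\beta\}$, if $\mathcal Z^+(x,y)=\mathcal Z^+(\alpha,\beta)$. The set of equivalence classes of $\sim_{\mathcal D}$ on $V^{(2)}$ is denoted $\mathcal P(\mathcal D)$. A system of pairs with parameters $(v,n,t)$ on $V$ is a partition of $V^{(2)}$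 into $n$ families (subsystems) of $t$ pairs each ($n,t\geqslant1$, $nt=\frac{v(v-1)}2$) such that no subsystem contains any element of $V$ more than once. Saying that $\mathcal P(\mathcal D)$ is a system of pairs means that its classes are the subsystems of a system of pairs. *)

theory Defs
  imports "HOL-Algebra.Group_Action" "HOL-Library.Ramsey" "HOL-Library.Disjoint_Sets"
    "HOL-Library.Indicator_Function" "HOL-Combinatorics.Permutations"
begin

(* The collection of blocks is the family B 1, ..., B b, so that repetitions are allowed; the
   values of B outside {1..b} are irrelevant.  The set of unordered pairs of distinct elements
   of V is nsets V 2. *)

locale block_design =
  fixes V :: "'a set" and B :: "nat \<Rightarrow> 'a set" and v b r k lam :: nat
  assumes finite_points: "finite V"
    and card_points: "card V = v"
    and params_pos: "b \<ge> 1" "r \<ge> 1" "k \<ge> 1" "lam \<ge> 1"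
    and k_less_v: "k < v"
    and block_subset: "\<And>j. j \<in> {1..b} \<Longrightarrow> B j \<subseteq> V"
    and card_block: "\<And>j. j \<in> {1..b} \<Longrightarrow> card (B j) = k"
    and point_degree: "\<And>x. x \<in> V \<Longrightarrow> card {j \<in> {1..b}. x \<in> B j} = r"
    and pair_degree: "\<And>p. p \<in> nsets V 2 \<Longrightarrow> card {j \<in> {1..b}. p \<subseteq> B j} = lam"

definition design_automorphisms :: "'a set \<Rightarrow> (nat \<Rightarrow> 'a set) \<Rightarrow> nat \<Rightarrow> ('a \<Rightarrow> 'a) set" where
  "design_automorphisms V B b =
     {\<phi> \<in> Bij V. \<exists>\<pi>. \<pi> permutes {1..b} \<and> (\<forall>j\<in>{1..b}. \<phi> ` B j = B (\<pi> j))}"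

definition design_aut_group :: "'a set \<Rightarrow> (nat \<Rightarrow> 'a set) \<Rightarrow> nat \<Rightarrow> ('a \<Rightarrow> 'a) monoid" where
  "design_aut_group V B b = (BijGroup V)\<lparr>carrier := design_automorphisms V B b\<rparr>"

(* Elements of BijGroup are extensional functions, hence the restriction. *)
definition pair_action :: "'a set \<Rightarrow> ('a \<Rightarrow> 'a) \<Rightarrow> 'a set \<Rightarrow> 'a set" where
  "pair_action V \<phi> = (\<lambda>p \<in> nsets V 2. \<phi> ` p)"

definition Z_plus :: "(nat \<Rightarrow> 'a set) \<Rightarrow> nat \<Rightarrow> 'a \<Rightarrow> 'a \<Rightarrow> nat \<Rightarrow> int" where
  "Z_plus B b x y = (\<lambda>j \<in> {1..b}. \<bar>indicator (B j) x - indicator (B j) y\<bar>)"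

definition pair_equiv :: "'a set \<Rightarrow> (nat \<Rightarrow> 'a set) \<Rightarrow> nat \<Rightarrow> ('a set \<times> 'a set) set" where
  "pair_equiv V B b =
     {(p, q). p \<in> nsets V 2 \<and> q \<in> nsets V 2 \<and>
        (\<exists>x y \<alpha> \<beta>. p = {x, y} \<and> q = {\<alpha>, \<beta>} \<and> Z_plus B b x y = Z_plus B b \<alpha> \<beta>)}"

definition pair_classes :: "'a set \<Rightarrow> (nat \<Rightarrow> 'a set) \<Rightarrow> nat \<Rightarrow> 'a set set set" where
  "pair_classes V B b = nsets V 2 // pair_equiv V B b"

(* The condition on a subsystem T to contain no element of V more than once
   says that distinct pairs in T are disjoint. *)
definition system_of_pairs_with ::
    "'a set \<Rightarrow> nat \<Rightarrow> nat \<Rightarrow> nat \<Rightarrow> 'a set set set \<Rightarrow> bool" where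
  "system_of_pairs_with V v n t S \<longleftrightarrow>
     finite V \<and> card V = v \<and> n \<ge> 1 \<and> t \<ge> 1 \<and> n * t = v * (v - 1) div 2 \<and>
     partition_on (nsets V 2) S \<and> card S = n \<and>
     (\<forall>T\<in>S. card T = t \<and> disjoint T)"

definition system_of_pairs :: "'a set \<Rightarrow> 'a set set set \<Rightarrow> bool" where
  "system_of_pairs V S \<longleftrightarrow> (\<exists>v n t. system_of_pairs_with V v n t S)"

lemma Z_plus_commute: "Z_plus B b x y = Z_plus B b y x"
  by (simp add: Z_plus_def abs_minus_commute)

lemma pair_equiv_iff:
  assumes "{x, y} \<in> nsets V 2" "{\<alpha>, \<beta>} \<in> nsets V 2"
  shows "({x, y}, {\<alpha>, \<beta>}) \<in> pair_equiv V B b \<longleftrightarrow> Z_plus B b x y = Z_plus B b \<alpha> \<beta>"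
  using assms by (auto simp: pair_equiv_def doubleton_eq_iff Z_plus_commute)

lemma equiv_pair_equiv: "equiv (nsets V 2) (pair_equiv V B b)"
proof (rule equivI)
  show "pair_equiv V B b \<subseteq> nsets V 2 \<times> nsets V 2"
    by (auto simp: pair_equiv_def)
  show "refl_on (nsets V 2) (pair_equiv V B b)"
  proof (rule refl_onI)
    fix p assume p: "p \<in> nsets V 2"
    then obtain x y where "p = {x, y}" by (auto simp: nsets_def card_2_iff)
    with p show "(p, p) \<in> pair_equiv V B b" by (simp add: pair_equiv_iff)
  qed
  show "sym (pair_equiv V B b)"
    unfolding sym_def pair_equiv_def by clarsimp metis
  show "trans (pair_equiv V B b)"
  proof (rule transI)
    fix p q s assume a: "(p, q) \<in> pair_equiv V B b" "(q, s) \<in> pair_equiv V B b"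
    then obtain x y \<alpha> \<beta> where 1: "p = {x, y}" "q = {\<alpha>, \<beta>}" by (auto simp: pair_equiv_def)
    obtain \<gamma> \<delta> where 2: "s = {\<gamma>, \<delta>}" using a by (auto simp: pair_equiv_def)
    have "{x, y} \<in> nsets V 2" "{\<alpha>, \<beta>} \<in> nsets V 2" "{\<gamma>, \<delta>} \<in> nsets V 2"
      using a 1 2 by (auto simp: pair_equiv_def)
    with a show "(p, s) \<in> pair_equiv V B b" unfolding 1 2 by (simp add: pair_equiv_iff)
  qed
qed

lemma (in block_design) compose_image_block:
  assumes "j \<in> {1..b}"
  shows "compose V f g ` B j = f ` g ` B j"
  using block_subset[OF assms] by (force simp: compose_def image_iff)

lemma (in block_design) subgroup_design_automorphisms:
  "subgroup (design_automorphisms V B b) (BijGroup V)"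
proof (rule group.subgroupI[OF group_BijGroup])
  show "design_automorphisms V B b \<subseteq> carrier (BijGroup V)"
    by (auto simp: design_automorphisms_def BijGroup_def)
  have "(\<lambda>x\<in>V. x) ` B j = B j" if "j \<in> {1..b}" for j
    using block_subset[OF that] by force
  then have "(\<lambda>x\<in>V. x) \<in> design_automorphisms V B b"
    by (auto simp: design_automorphisms_def id_Bij intro!: exI[of _ id] permutes_id)
  then show "design_automorphisms V B b \<noteq> {}" by blast
next
  fix f assume "f \<in> design_automorphisms V B b"
  then obtain \<pi> where f: "f \<in> Bij V" and \<pi>: "\<pi> permutes {1..b}"
    and eq: "\<And>j. j \<in> {1..b} \<Longrightarrow> f ` B j = B (\<pi> j)"
    by (auto simp: design_automorphisms_def)
  let ?g = "restrict (inv_into V f) V"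
  have inj: "inj_on f V" using f by (simp add: Bij_def bij_betw_def)
  have "?g ` B j = B (inv_into UNIV \<pi> j)" if j: "j \<in> {1..b}" for j
  proof -
    have i: "inv_into UNIV \<pi> j \<in> {1..b}" using permutes_in_image[OF permutes_inv[OF \<pi>]] j by blast
    have "f ` B (inv_into UNIV \<pi> j) = B j" using eq[OF i] permutes_inverses(1)[OF \<pi>] by simp
    moreover have "inv_into V f ` f ` B (inv_into UNIV \<pi> j) = B (inv_into UNIV \<pi> j)"
      using inv_into_image_cancel[OF inj block_subset[OF i]] .
    moreover have "?g ` B j = inv_into V f ` B j"
      using block_subset[OF j] by (intro image_cong) auto
    ultimately show ?thesis by simp
  qed
  then show "inv\<^bsub>BijGroup V\<^esub> f \<in> design_automorphisms V B b"
    using f permutes_inv[OF \<pi>]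
    by (auto simp: inv_BijGroup design_automorphisms_def restrict_inv_into_Bij)
next
  fix f g assume "f \<in> design_automorphisms V B b" "g \<in> design_automorphisms V B b"
  then obtain \<pi> \<sigma> where f: "f \<in> Bij V" "\<pi> permutes {1..b}"
      "\<And>j. j \<in> {1..b} \<Longrightarrow> f ` B j = B (\<pi> j)"
    and g: "g \<in> Bij V" "\<sigma> permutes {1..b}"
      "\<And>j. j \<in> {1..b} \<Longrightarrow> g ` B j = B (\<sigma> j)"
    by (auto simp: design_automorphisms_def)
  have "compose V f g ` B j = B ((\<pi> \<circ> \<sigma>) j)" if "j \<in> {1..b}" for j
    using that f(3) g(3) permutes_in_image[OF g(2)] by (simp add: compose_image_block)
  then show "f \<otimes>\<^bsub>BijGroup V\<^esub> g \<in> design_automorphisms V B b"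
    using f g permutes_compose[OF g(2) f(2)]
    by (auto simp: BijGroup_def design_automorphisms_def compose_Bij)
qed

lemma (in block_design) group_design_aut_group: "group (design_aut_group V B b)"
  unfolding design_aut_group_def
  by (rule group.subgroup_imp_group[OF group_BijGroup subgroup_design_automorphisms])

lemma pair_action_Bij:
  assumes "f \<in> Bij V"
  shows "pair_action V f \<in> Bij (nsets V 2)"
  using bij_betw_nsets[of f V V 2] assms
  by (auto simp: Bij_def pair_action_def)

lemma pair_action_compose:
  assumes "g \<in> Bij V"
  shows "pair_action V (compose V f g) = compose (nsets V 2) (pair_action V f) (pair_action V g)"
proof
  fix p
  show "pair_action V (compose V f g) p =
      compose (nsets V 2) (pair_action V f) (pair_action V g) p"
  proof (cases "p \<in> nsets V 2")
    case True
    then have "compose V f g ` p = f ` g ` p"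
      by (force simp: nsets_def compose_def image_iff)
    moreover have "g ` p \<in> nsets V 2"
      using pair_action_Bij[OF assms] True
      by (auto simp: Bij_def bij_betw_def pair_action_def)
    ultimately show ?thesis using True by (simp add: pair_action_def compose_def)
  qed (simp add: pair_action_def compose_def)
qed

lemma (in block_design) group_action_pair_action:
  assumes "subgroup G (design_aut_group V B b)"
  shows "group_action ((design_aut_group V B b)\<lparr>carrier := G\<rparr>) (nsets V 2) (pair_action V)"
proof -
  have sub: "G \<subseteq> Bij V"
    using subgroup.subset[OF assms]
    by (auto simp: design_aut_group_def design_automorphisms_def)
  have "group ((design_aut_group V B b)\<lparr>carrier := G\<rparr>)"
    by (rule group.subgroup_imp_group[OF group_design_aut_group assms])
  moreover have "pair_action V \<in>
      hom ((design_aut_group V B b)\<lparr>carrier := G\<rparr>) (BijGroup (nsets V 2))"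
    using sub
    by (auto simp: hom_def design_aut_group_def BijGroup_def subset_iff
        pair_action_Bij pair_action_compose)
  ultimately show ?thesis
    by (simp add: group_action_def group_hom_def group_hom_axioms_def group_BijGroup)
qed

end

theory Submission
  imports Defs
begin

text \<open>If two equivalent pairs shared exactly one point, the two remaining points would lie in the
  same blocks, so \<open>\<lambda> = r\<close>; then any block through one point contains all points, contradicting
  \<open>k < v\<close>. Automorphisms permute the coordinates of \<open>\<Z>\<^sup>+\<close> and hence preserve the equivalence, so
  transitivity on pairs makes all classes equally large.\<close>

text \<open>Entry \<open>j\<close> is 0 if \<open>B j\<close> contains both points or neither, and 1
  if it separates them. Outside \<open>{1..b}\<close> both vectors are \<open>undefined\<close>, so
  only these coordinates matter.\<close>

lemma Z_plus_eq_iff: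
  "Z_plus B b x y = Z_plus B b \<alpha> \<beta> \<longleftrightarrow>
     (\<forall>j\<in>{1..b}. (x \<in> B j \<longleftrightarrow> y \<in> B j) \<longleftrightarrow> (\<alpha> \<in> B j \<longleftrightarrow> \<beta> \<in> B j))"
proof -
  have "Z_plus B b x y = Z_plus B b \<alpha> \<beta> \<longleftrightarrow>
      (\<forall>j\<in>{1..b}. Z_plus B b x y j = Z_plus B b \<alpha> \<beta> j)"
    by (auto simp: fun_eq_iff Z_plus_def)
  also have "\<dots> \<longleftrightarrow> (\<forall>j\<in>{1..b}. (x \<in> B j \<longleftrightarrow> y \<in> B j) \<longleftrightarrow> (\<alpha> \<in> B j \<longleftrightarrow> \<beta> \<in> B j))"
    by (intro ball_cong refl) (auto simp: Z_plus_def indicator_def)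
  finally show ?thesis .
qed

lemma nsets_2_obtain:
  assumes "p \<in> nsets V 2"
  obtains x y where "p = {x, y}" "x \<in> V" "y \<in> V" "x \<noteq> y"
  using assms by (auto simp: nsets_def card_2_iff)

lemma doubleton_in_nsets_2: "{x, y} \<in> nsets V 2 \<longleftrightarrow> x \<in> V \<and> y \<in> V \<and> x \<noteq> y"
  by (auto simp: nsets_def card_2_iff doubleton_eq_iff)

lemma (in block_design) points_eqI:
  assumes y: "y \<in> V" and z: "z \<in> V"
    and same: "\<And>j. j \<in> {1..b} \<Longrightarrow> y \<in> B j \<longleftrightarrow> z \<in> B j"
  shows "y = z"
proof (rule ccontr)
  assume "y \<noteq> z"
  \<comment> \<open>One set of blocks is counted twice: as blocks through a pair
    (\<open>lam\<close>) and as blocks through a point (\<open>r\<close>).\<close>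
  have "{j \<in> {1..b}. {y, z} \<subseteq> B j} = {j \<in> {1..b}. y \<in> B j}"
    using same by auto
  then have "lam = r"
    using pair_degree[of "{y, z}"] point_degree[OF y] y z \<open>y \<noteq> z\<close>
    by (simp add: doubleton_in_nsets_2)
  \<comment> \<open>The blocks through \<open>y\<close> and \<open>w\<close> form a subset, of the
    same finite size \<open>lam = r\<close>, of the blocks through \<open>y\<close>, so the two sets
    coincide.\<close>
  have through: "w \<in> B j" if w: "w \<in> V" and j: "j \<in> {1..b}" "y \<in> B j" for w j
  proof (cases "w = y")
    case False
    have "{j \<in> {1..b}. {y, w} \<subseteq> B j} = {j \<in> {1..b}. y \<in> B j}"
      using pair_degree[of "{y, w}"] point_degree[OF y] y w False \<open>lam = r\<close>
      by (intro card_subset_eq) (auto simp: doubleton_in_nsets_2)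
    with j show ?thesis by blast
  qed (use j in simp)
  have "{j \<in> {1..b}. y \<in> B j} \<noteq> {}"
    using point_degree[OF y] params_pos(2) by (metis card.empty not_one_le_zero)
  then obtain j where j: "j \<in> {1..b}" "y \<in> B j" by blast
  then have "B j = V" using through block_subset by blast
  then show False using card_block[OF j(1)] card_points k_less_v by simp
qed

lemma (in block_design) disjoint_pair_class:
  assumes "T \<in> pair_classes V B b"
  shows "disjoint T"
proof (rule disjointI)
  fix p q assume pq: "p \<in> T" "q \<in> T" "p \<noteq> q"
  then have rel: "(p, q) \<in> pair_equiv V B b"
    using assms quotient_eq_iff[OF equiv_pair_equiv, of T V B b T p q]
    by (simp add: pair_classes_def)
  show "p \<inter> q = {}"
  proof (rule ccontr)
    assume "p \<inter> q \<noteq> {}"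
    then obtain x where x: "x \<in> p" "x \<in> q" by blast
    have sets: "p \<in> nsets V 2" "q \<in> nsets V 2" using rel by (auto simp: pair_equiv_def)
    obtain y where y: "p = {x, y}" by (rule nsets_2_obtain[OF sets(1)]) (use x in auto)
    obtain z where z: "q = {x, z}" by (rule nsets_2_obtain[OF sets(2)]) (use x in auto)
    have "Z_plus B b x y = Z_plus B b x z"
      using rel sets unfolding y z by (simp add: pair_equiv_iff)
    \<comment> \<open>In each block the membership of the common point \<open>x\<close> cancels from
      the equivalence, leaving \<open>y\<close> and \<open>z\<close> in the same blocks.\<close>
    then have "y = z"
      using sets unfolding y z Z_plus_eq_iff doubleton_in_nsets_2 by (intro points_eqI) auto
    with y z pq(3) show False by simp
  qed
qed

text \<open>Since \<open>f x\<close> lies in \<open>B (\<pi> j)\<close> exactly when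
  \<open>x\<close> lies in \<open>B j\<close>, applying \<open>f\<close> to a pair only reindexes
  its vector by \<open>\<pi>\<close>.\<close>

lemma (in block_design) automorphism_pair_equiv:
  assumes f: "f \<in> design_automorphisms V B b" and pq: "(p, q) \<in> pair_equiv V B b"
  shows "(f ` p, f ` q) \<in> pair_equiv V B b"
proof -
  obtain \<pi> where bij: "bij_betw f V V" and \<pi>: "\<pi> permutes {1..b}"
    and eq: "\<And>j. j \<in> {1..b} \<Longrightarrow> f ` B j = B (\<pi> j)"
    using f by (auto simp: design_automorphisms_def Bij_def)
  have inj: "inj_on f V" and ran: "\<And>x. x \<in> V \<Longrightarrow> f x \<in> V"
    using bij by (auto simp: bij_betw_def)
  have mem: "f x \<in> B (\<pi> j) \<longleftrightarrow> x \<in> B j" if "x \<in> V" "j \<in> {1..b}" for x j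
    using inj_on_image_mem_iff[OF inj that(1) block_subset[OF that(2)]] eq[OF that(2)] by simp
  have sets: "p \<in> nsets V 2" "q \<in> nsets V 2" using pq by (auto simp: pair_equiv_def)
  obtain x y where p: "p = {x, y}" "x \<in> V" "y \<in> V" "x \<noteq> y" using sets(1) by (rule nsets_2_obtain)
  obtain \<alpha> \<beta> where q: "q = {\<alpha>, \<beta>}" "\<alpha> \<in> V" "\<beta> \<in> V" "\<alpha> \<noteq> \<beta>" using sets(2) by (rule nsets_2_obtain)
  have "Z_plus B b x y = Z_plus B b \<alpha> \<beta>"
    using pq sets unfolding p(1) q(1) by (simp add: pair_equiv_iff)
  then have "\<forall>j\<in>{1..b}. (f x \<in> B (\<pi> j) \<longleftrightarrow> f y \<in> B (\<pi> j)) \<longleftrightarrow> (f \<alpha> \<in> B (\<pi> j) \<longleftrightarrow> f \<beta> \<in> B (\<pi> j))"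
    using p q mem by (simp add: Z_plus_eq_iff)
  \<comment> \<open>As \<open>\<pi>\<close> maps \<open>{1..b}\<close> onto itself, the indices
    \<open>\<pi> j\<close> exhaust all coordinates.\<close>
  then have "\<forall>j\<in>\<pi> ` {1..b}. (f x \<in> B j \<longleftrightarrow> f y \<in> B j) \<longleftrightarrow> (f \<alpha> \<in> B j \<longleftrightarrow> f \<beta> \<in> B j)"
    by blast
  then have "Z_plus B b (f x) (f y) = Z_plus B b (f \<alpha>) (f \<beta>)"
    unfolding Z_plus_eq_iff permutes_image[OF \<pi>] .
  moreover have "{f x, f y} \<in> nsets V 2" "{f \<alpha>, f \<beta>} \<in> nsets V 2"
    using p q ran inj by (auto simp: doubleton_in_nsets_2 inj_on_eq_iff)
  ultimately show ?thesis by (simp add: p(1) q(1) pair_equiv_iff)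
qed

lemma (in block_design) card_pair_class_le:
  assumes f: "f \<in> design_automorphisms V B b" and p: "p \<in> nsets V 2"
  shows "card (pair_equiv V B b `` {p}) \<le> card (pair_equiv V B b `` {f ` p})"
proof (rule card_inj_on_le)
  have "inj_on f V" using f by (auto simp: design_automorphisms_def Bij_def bij_betw_def)
  then have "inj_on ((`) f) (Pow V)" by (rule inj_on_image_Pow)
  then show "inj_on ((`) f) (pair_equiv V B b `` {p})"
    by (rule inj_on_subset) (auto simp: pair_equiv_def nsets_def)
  show "(`) f ` (pair_equiv V B b `` {p}) \<subseteq> pair_equiv V B b `` {f ` p}"
    using automorphism_pair_equiv[OF f] by auto
  have "finite (nsets V 2)" using finite_points by (rule finite_imp_finite_nsets)
  then show "finite (pair_equiv V B b `` {f ` p})"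
    by (rule rev_finite_subset) (auto simp: pair_equiv_def)
qed

theorem proposition1:
  fixes V :: "'a set" and B :: "nat \<Rightarrow> 'a set" and v b r k lam :: nat
  assumes "block_design V B v b r k lam"
    and "\<exists>G. subgroup G (design_aut_group V B b) \<and>
           transitive_action ((design_aut_group V B b)\<lparr>carrier := G\<rparr>) (nsets V 2) (pair_action V)"
  shows "system_of_pairs V (pair_classes V B b)"
proof -
  interpret block_design V B v b r k lam by fact
  obtain G where G: "subgroup G (design_aut_group V B b)"
    and trans: "transitive_action ((design_aut_group V B b)\<lparr>carrier := G\<rparr>) (nsets V 2) (pair_action V)"
    using assms(2) by blast
  let ?P = "nsets V 2" and ?R = "pair_equiv V B b" and ?S = "pair_classes V B b"
  have le: "card (?R `` {p}) \<le> card (?R `` {q})" if "p \<in> ?P" "q \<in> ?P" for p q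
  proof -
    have "\<exists>f\<in>G. pair_action V f p = q"
      using transitive_action.unique_orbit[OF trans] that by simp
    then obtain f where "f \<in> G" "pair_action V f p = q" by blast
    moreover have "G \<subseteq> design_automorphisms V B b"
      using subgroup.subset[OF G] by (simp add: design_aut_group_def)
    ultimately show ?thesis
      using card_pair_class_le[of f p] that(1) by (auto simp: pair_action_def)
  qed
  have fin: "finite ?P" using finite_points by (rule finite_imp_finite_nsets)
  have card_P: "card ?P = v * (v - 1) div 2"
    by (simp add: card_nsets card_points choose_two)
  \<comment> \<open>There is at least one pair, which serves to define \<open>t\<close> and later
    makes both parameters positive.\<close>
  have "2 \<le> v" using k_less_v params_pos(3) by simp
  then have "card ?P \<ge> 1"
    using card_P div_le_mono[OF mult_le_mono[of 2 v 1 "v - 1"], of 2] by simp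
  then obtain p where p: "p \<in> ?P"
    by (metis card.empty ex_in_conv not_one_le_zero)
  have part: "partition_on ?P ?S"
    unfolding pair_classes_def using equiv_pair_equiv by (rule partition_on_quotient)
  define t where "t = card (?R `` {p})"
  \<comment> \<open>\<open>le\<close> is used in both directions between the fixed pair
    \<open>p\<close> and a representative of \<open>T\<close>.\<close>
  have size: "card T = t" if "T \<in> ?S" for T
    using that le[OF p] le[OF _ p] unfolding t_def pair_classes_def
    by (auto elim!: quotientE intro: le_antisym)
  have "finite T" if "T \<in> ?S" for T
    using that partition_onD1[OF part] finite_subset[OF _ fin] by blast
  then have "card ?S * t = card ?P"
    using product_partition[OF part] size by simp
  \<comment> \<open>Neither the number of classes nor \<open>t\<close> can be 0, since their product
    is \<open>card ?P\<close>.\<close>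
  with card_P \<open>card ?P \<ge> 1\<close> have "system_of_pairs_with V v (card ?S) t ?S"
    unfolding system_of_pairs_with_def
    using finite_points card_points part size disjoint_pair_class
    by (auto simp: Suc_le_eq intro!: Nat.gr0I)
  then show ?thesis unfolding system_of_pairs_def by blast
qed

end
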